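(* Let $\lambda_1,\lambda_2,b,c\in\mathbb{R}$ and let $$A=\begin{bmatrix}\lambda_1&0\\0&\lambda_2\end{bmatrix},\qquad B=\begin{bmatrix}0&b\\c&0\end{bmatrix}.$$ Then $\{A,B\}$ has the spectral finiteness property, and its generalized spectral radius $\boldsymbol{\rho}$ satisfies $\boldsymbol{\rho}=\max\{\rho(A),\rho(B)\}$.
   Context: For a square matrix $M$, $\rho(M)$ denotes its usual spectral radius (the maximum modulus of its complex eigenvalues). For a finite set $\boldsymbol{A}$ of real square matrices of the same size and $n\ge 1$, put $\boldsymbol{A}^n=\{M_1\cdots M_n : M_i\in\boldsymbol{A}\text{ for }1\le i\le n\}$. The generalized spectral radius of $\boldsymbol{A}$ is $$\boldsymbol{\rho}=\sup_{n\ge 1}\max_{M\in\boldsymbol{A}^n}\sqrt[n]{\rho(M)}.$$ The set $\boldsymbol{A}$ has the spectral finiteness property if there exist some $n\ge 1$ and some $M\in\boldsymbol{A}^n$ such that $\boldsymbol{\rho}=\sqrt[n]{\rho(M)}$. *)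

theory Defs
  imports "Jordan_Normal_Form.Spectral_Radius"
begin

definition real_spectral_radius :: "real mat \<Rightarrow> real" where
  "real_spectral_radius M = spectral_radius (map_mat complex_of_real M)"

(* The library matrices carry no type-level dimension, so the common size d of the
   matrices is passed explicitly. It is only used for the unit matrix that ends the product. *)
definition mat_set_pow :: "nat \<Rightarrow> real mat set \<Rightarrow> nat \<Rightarrow> real mat set" where
  "mat_set_pow d S n = {foldr (*) Ms (1\<^sub>m d) | Ms. length Ms = n \<and> set Ms \<subseteq> S}"

(* To be used for finite nonempty sets S of d x d matrices with d > 0. Then every
   mat_set_pow d S n is finite and nonempty, so that Max is meaningful, and the set below
   Sup is nonempty and bounded above (by the largest operator norm of a member of S), so
   that the real supremum is meaningful. *)
definition generalized_spectral_radius :: "nat \<Rightarrow> real mat set \<Rightarrow> real" where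
  "generalized_spectral_radius d S =
     (SUP n\<in>{1..}. Max ((\<lambda>M. root n (real_spectral_radius M)) ` mat_set_pow d S n))"

definition spectral_finiteness_property :: "nat \<Rightarrow> real mat set \<Rightarrow> bool" where
  "spectral_finiteness_property d S \<longleftrightarrow>
     (\<exists>n\<ge>1. \<exists>M\<in>mat_set_pow d S n.
        generalized_spectral_radius d S = root n (real_spectral_radius M))"

end

theory Submission
  imports Defs
begin

text \<open>Left multiplication by A preserves the diagonal and the antidiagonal shape, and left
  multiplication by B swaps them, so every product of n factors has one of the two shapes. Its
  spectral radius is then explicit: the larger modulus on the diagonal, or the square root of |q r|
  for antidiagonal entries q, r. Let m be the larger of the radii of A and B, so |l1|, |l2| \<le> m
  and |b c| \<le> m^2. A single antidiagonal entry need not be bounded by m^n, as b may be huge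
  while c = 0. But a diagonal entry of a product uses b and c equally often, and so does q r; hence
  the factors pair up and the radius of the product is at most m^n. The induction is
  \<open>foldr_diagonal_antidiagonal\<close>. By \<open>generalized_spectral_radius_attained\<close>
  the supremum is then m, attained by a single factor.\<close>

definition mat2 :: "'a \<Rightarrow> 'a \<Rightarrow> 'a \<Rightarrow> 'a \<Rightarrow> 'a mat" where
  "mat2 p q r s = mat_of_rows_list 2 [[p, q], [r, s]]"

lemma mat2_carrier [simp]: "mat2 p q r s \<in> carrier_mat 2 2"
  by (simp add: mat2_def mat_of_rows_list_def numeral_2_eq_2)

lemma mat2_index [simp]:
  "mat2 p q r s $$ (0, 0) = p" "mat2 p q r s $$ (0, Suc 0) = q"
  "mat2 p q r s $$ (Suc 0, 0) = r" "mat2 p q r s $$ (Suc 0, Suc 0) = s"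
  by (simp_all add: mat2_def mat_of_rows_list_def)

lemma mat2_dim [simp]: "dim_row (mat2 p q r s) = 2" "dim_col (mat2 p q r s) = 2"
  by (simp_all add: mat2_def mat_of_rows_list_def)

lemma mat2_mult:
  fixes p q r s :: "'a :: comm_semiring_1"
  shows "mat2 p q r s * mat2 p' q' r' s' =
    mat2 (p * p' + q * r') (p * q' + q * s') (r * p' + s * r') (r * q' + s * s')"
  by (rule eq_matI) (auto simp: scalar_prod_def numeral_2_eq_2 less_Suc_eq)

lemma map_mat2: "map_mat f (mat2 p q r s) = mat2 (f p) (f q) (f r) (f s)"
  by (rule eq_matI) (auto simp: less_2_cases_iff)

lemma one_mat2: "1\<^sub>m 2 = mat2 1 0 0 (1 :: 'a :: comm_semiring_1)"
  by (rule eq_matI) (auto simp: less_2_cases_iff)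

lemma det_mat2:
  fixes p q r s :: "'a :: comm_ring_1"
  shows "det (mat2 p q r s) = p * s - q * r"
proof -
  have "det (mat2 p q r s) = (\<Sum>j<2. mat2 p q r s $$ (0, j) * cofactor (mat2 p q r s) 0 j)"
    by (rule laplace_expansion_row) auto
  also have "\<dots> = p * s - q * r"
    by (simp add: numeral_2_eq_2 cofactor_def mat_delete_def det_dim_zero det_single)
  finally show ?thesis .
qed

text \<open>This is the characteristic equation, arranged so that q = r = 0 splits it into linear
  factors and p = s = 0 leaves k^2 = q r.\<close>

lemma spectrum_mat2:
  fixes p q r s :: "'a :: field"
  shows "spectrum (mat2 p q r s) = {k. (k - p) * (k - s) = q * r}"
proof -
  have char: "char_matrix (mat2 p q r s) k = mat2 (p - k) q r (s - k)" for k
    by (rule eq_matI) (auto simp: char_matrix_def less_2_cases_iff)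
  have "eigenvalue (mat2 p q r s) k \<longleftrightarrow> (p - k) * (s - k) - q * r = 0" for k
    using eigenvalue_det[of "mat2 p q r s" 2 k] by (simp add: char det_mat2)
  then show ?thesis
    by (auto simp: spectrum_def algebra_simps)
qed

lemma real_spectral_radius_diagonal:
  "real_spectral_radius (mat2 p 0 0 q) = max \<bar>p\<bar> \<bar>q\<bar>"
proof -
  have "spectrum (mat2 (complex_of_real p) 0 0 (complex_of_real q)) =
      {complex_of_real p, complex_of_real q}"
    by (auto simp: spectrum_mat2)
  then show ?thesis
    by (simp add: real_spectral_radius_def spectral_radius_def map_mat2)
qed

text \<open>The eigenvalues are the complex square roots of p q, which share one modulus whatever
  the sign of p q.\<close>

lemma real_spectral_radius_antidiagonal:
  "real_spectral_radius (mat2 0 p q 0) = sqrt \<bar>p * q\<bar>"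
proof -
  let ?S = "spectrum (mat2 0 (complex_of_real p) (complex_of_real q) 0)"
  have S: "?S = {k. k\<^sup>2 = complex_of_real (p * q)}"
    by (simp add: spectrum_mat2 power2_eq_square)
  have "cmod k = sqrt \<bar>p * q\<bar>" if "k \<in> ?S" for k
  proof -
    have "(cmod k)\<^sup>2 = \<bar>p * q\<bar>"
      using that by (simp only: S mem_Collect_eq norm_of_real flip: norm_power)
    then show ?thesis
      by (metis norm_ge_zero real_sqrt_unique)
  qed
  \<comment> \<open>A witness that the spectrum is nonempty, so that the set of moduli is a
    singleton and not empty.\<close>
  moreover have "csqrt (complex_of_real (p * q)) \<in> ?S"
    by (simp only: S mem_Collect_eq power2_csqrt)
  ultimately have "cmod ` ?S = {sqrt \<bar>p * q\<bar>}"
    by (auto simp del: of_real_mult)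
  then show ?thesis
    by (simp add: real_spectral_radius_def spectral_radius_def map_mat2)
qed

lemma finite_mat_set_pow:
  assumes "finite S"
  shows "finite (mat_set_pow d S n)"
proof -
  have "mat_set_pow d S n = (\<lambda>Ms. foldr (*) Ms (1\<^sub>m d)) ` {Ms. set Ms \<subseteq> S \<and> length Ms = n}"
    unfolding mat_set_pow_def by auto
  then show ?thesis
    using finite_lists_length_eq[OF assms] by simp
qed

lemma mat_set_pow_nonempty:
  assumes "S \<noteq> {}"
  shows "mat_set_pow d S n \<noteq> {}"
proof -
  obtain M where "M \<in> S" using assms by blast
  then have "foldr (*) (replicate n M) (1\<^sub>m d) \<in> mat_set_pow d S n"
    unfolding mat_set_pow_def by fastforce
  then show ?thesis by blast
qed

lemma mem_mat_set_pow_1: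
  assumes "M \<in> S" "M \<in> carrier_mat d d"
  shows "M \<in> mat_set_pow d S 1"
proof -
  have "M = foldr (*) [M] (1\<^sub>m d)" "length [M] = 1" "set [M] \<subseteq> S"
    using assms by auto
  then show ?thesis
    unfolding mat_set_pow_def by blast
qed

text \<open>Taking n-th roots in \<open>bound\<close> caps every term of the supremum by the radius
  of M, and M itself, as a word of length one, reaches this cap.\<close>

lemma generalized_spectral_radius_attained:
  assumes "finite S" "M \<in> S" "M \<in> carrier_mat d d"
    and nonneg: "0 \<le> real_spectral_radius M"
    and bound: "\<And>n N. N \<in> mat_set_pow d S n \<Longrightarrow> real_spectral_radius N \<le> real_spectral_radius M ^ n"
  shows "generalized_spectral_radius d S = real_spectral_radius M"
    and "spectral_finiteness_property d S"
proof -
  let ?f = "\<lambda>n. Max ((\<lambda>M. root n (real_spectral_radius M)) ` mat_set_pow d S n)"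
  have M: "M \<in> mat_set_pow d S 1"
    using assms by (intro mem_mat_set_pow_1)
  have le: "?f n \<le> real_spectral_radius M" if "n \<in> {1..}" for n
  proof -
    have "root n (real_spectral_radius N) \<le> real_spectral_radius M" if "N \<in> mat_set_pow d S n" for N
    proof -
      have "root n (real_spectral_radius N) \<le> root n (real_spectral_radius M ^ n)"
        using bound[OF that] \<open>n \<in> {1..}\<close> by (intro real_root_le_mono) auto
      also have "\<dots> = real_spectral_radius M"
        using \<open>n \<in> {1..}\<close> nonneg by (intro real_root_power_cancel) auto
      finally show ?thesis .
    qed
    then show ?thesis
      using finite_mat_set_pow[OF \<open>finite S\<close>] mat_set_pow_nonempty[of S d n] \<open>M \<in> S\<close>
      by (subst Max_le_iff) blast+
  qed
  have "root 1 (real_spectral_radius M) \<le> ?f 1"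
    using M finite_mat_set_pow[OF \<open>finite S\<close>] by (intro Max_ge) auto
  then have "?f 1 = real_spectral_radius M"
    using le[of 1] by simp
  then show eq: "generalized_spectral_radius d S = real_spectral_radius M"
    unfolding generalized_spectral_radius_def
    using le by (intro cSup_eq_maximum) (auto intro!: image_eqI[where x = 1])
  show "spectral_finiteness_property d S"
    unfolding spectral_finiteness_property_def using M eq by (intro exI[of _ 1]) auto
qed

text \<open>In the antidiagonal case the two bounds on \<open>c * q\<close> and \<open>b * r\<close> control the diagonal entries
  that a further factor \<open>B\<close> produces; they replace a rescaling of \<open>B\<close> to entries of equal modulus,
  which is impossible when exactly one of \<open>b\<close> and \<open>c\<close> vanishes.\<close>

lemma foldr_diagonal_antidiagonal:
  fixes l1 l2 b c m :: real
  assumes m: "\<bar>l1\<bar> \<le> m" "\<bar>l2\<bar> \<le> m" "\<bar>b * c\<bar> \<le> m\<^sup>2"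
    and "set Ms \<subseteq> {mat2 l1 0 0 l2, mat2 0 b c 0}"
  shows "(\<exists>p s. foldr (*) Ms (1\<^sub>m 2) = mat2 p 0 0 s \<and> \<bar>p\<bar> \<le> m ^ length Ms \<and> \<bar>s\<bar> \<le> m ^ length Ms) \<or>
    (\<exists>q r. foldr (*) Ms (1\<^sub>m 2) = mat2 0 q r 0 \<and> \<bar>q * r\<bar> \<le> (m ^ length Ms)\<^sup>2 \<and>
      \<bar>c * q\<bar> \<le> m ^ Suc (length Ms) \<and> \<bar>b * r\<bar> \<le> m ^ Suc (length Ms))"
  using assms(4)
proof (induction Ms)
  case Nil
  have "foldr (*) [] (1\<^sub>m 2) = mat2 1 0 0 (1 :: real)"
    by (simp add: one_mat2)
  then show ?case by fastforce
next
  case (Cons M Ms)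
  let ?n = "length Ms"
  have m0: "0 \<le> m" using m by linarith
  from Cons.prems consider "M = mat2 l1 0 0 l2" | "M = mat2 0 b c 0" by auto
  note M = this
  from Cons consider
      (diag) p s where "foldr (*) Ms (1\<^sub>m 2) = mat2 p 0 0 s" "\<bar>p\<bar> \<le> m ^ ?n" "\<bar>s\<bar> \<le> m ^ ?n"
    | (anti) q r where "foldr (*) Ms (1\<^sub>m 2) = mat2 0 q r 0" "\<bar>q * r\<bar> \<le> (m ^ ?n)\<^sup>2"
        "\<bar>c * q\<bar> \<le> m ^ Suc ?n" "\<bar>b * r\<bar> \<le> m ^ Suc ?n"
    by auto
  then show ?case
  proof cases
    case diag
    from M show ?thesis
    proof cases
      case 1
      have "\<bar>l1 * p\<bar> \<le> m * m ^ ?n" "\<bar>l2 * s\<bar> \<le> m * m ^ ?n"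
        unfolding abs_mult using m m0 diag by (intro mult_mono; simp)+
      with 1 diag show ?thesis by (auto simp: mat2_mult)
    next
      case 2
      \<comment> \<open>The new antidiagonal entries are b s and c p. Multiplying each by its
        missing partner completes a factor b c, worth m^2, which is what the exponent n + 2 of the
        auxiliary bounds allows.\<close>
      have cs: "\<bar>(b * c) * s\<bar> \<le> m\<^sup>2 * m ^ ?n" and bp: "\<bar>(b * c) * p\<bar> \<le> m\<^sup>2 * m ^ ?n"
        unfolding abs_mult[of "b * c"] using m m0 diag by (intro mult_mono; simp)+
      have "\<bar>(b * c) * s * p\<bar> \<le> (m\<^sup>2 * m ^ ?n) * m ^ ?n"
        unfolding abs_mult[of "b * c * s"] using cs m0 diag by (intro mult_mono) simp_all
      then have "\<bar>(b * s) * (c * p)\<bar> \<le> (m ^ Suc ?n)\<^sup>2"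
        by (simp add: power2_eq_square mult_ac)
      moreover have "\<bar>c * (b * s)\<bar> \<le> m ^ Suc (Suc ?n)" "\<bar>b * (c * p)\<bar> \<le> m ^ Suc (Suc ?n)"
        using cs bp by (simp_all add: power2_eq_square mult_ac)
      ultimately show ?thesis
        using 2 diag by (simp add: mat2_mult) blast
    qed
  next
    case anti
    from M show ?thesis
    proof cases
      case 1
      \<comment> \<open>The new entries are l1 q and l2 r, so their product gains l1 l2, while each
        auxiliary bound gains one factor m.\<close>
      have "\<bar>l1\<bar> * \<bar>l2\<bar> \<le> m * m"
        using m m0 by (intro mult_mono) simp_all
      then have "(\<bar>l1\<bar> * \<bar>l2\<bar>) * \<bar>q * r\<bar> \<le> (m * m) * (m ^ ?n)\<^sup>2"
        by (rule mult_mono) (use anti m0 in simp_all)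
      then have "\<bar>(l1 * q) * (l2 * r)\<bar> \<le> (m ^ Suc ?n)\<^sup>2"
        by (simp add: abs_mult power2_eq_square mult_ac)
      moreover have "\<bar>l1\<bar> * \<bar>c * q\<bar> \<le> m * m ^ Suc ?n" "\<bar>l2\<bar> * \<bar>b * r\<bar> \<le> m * m ^ Suc ?n"
        using m m0 anti by (intro mult_mono; simp)+
      then have "\<bar>c * (l1 * q)\<bar> \<le> m ^ Suc (Suc ?n)" "\<bar>b * (l2 * r)\<bar> \<le> m ^ Suc (Suc ?n)"
        by (simp_all add: abs_mult mult_ac)
      ultimately show ?thesis
        using 1 anti by (simp add: mat2_mult) blast
    next
      case 2
      \<comment> \<open>The product is diagonal with entries b r and c q, so the auxiliary bounds of
        the induction hypothesis are exactly the claim.\<close>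
      with anti show ?thesis by (auto simp: mat2_mult)
    qed
  qed
qed

theorem theorem5:
  fixes l1 l2 b c :: real and A B :: "real mat"
  assumes "A = mat_of_rows_list 2 [[l1, 0], [0, l2]]"
    and "B = mat_of_rows_list 2 [[0, b], [c, 0]]"
  shows "spectral_finiteness_property 2 {A, B} \<and>
         generalized_spectral_radius 2 {A, B} = max (real_spectral_radius A) (real_spectral_radius B)"
proof -
  have A: "A = mat2 l1 0 0 l2" and B: "B = mat2 0 b c 0"
    using assms by (simp_all add: mat2_def)
  define m where "m = max (real_spectral_radius A) (real_spectral_radius B)"
  have rA: "real_spectral_radius A = max \<bar>l1\<bar> \<bar>l2\<bar>"
    and rB: "real_spectral_radius B = sqrt \<bar>b * c\<bar>"
    by (simp_all add: A B real_spectral_radius_diagonal real_spectral_radius_antidiagonal)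
  have m: "\<bar>l1\<bar> \<le> m" "\<bar>l2\<bar> \<le> m" "sqrt \<bar>b * c\<bar> \<le> m"
    by (simp_all add: m_def rA rB)
  then have m0: "0 \<le> m" and bc: "\<bar>b * c\<bar> \<le> m\<^sup>2"
    by (linarith, blast intro: sqrt_le_D)
  have bound: "real_spectral_radius N \<le> m ^ n" if N: "N \<in> mat_set_pow 2 {A, B} n" for n N
  proof -
    obtain Ms where "N = foldr (*) Ms (1\<^sub>m 2)" "length Ms = n" "set Ms \<subseteq> {A, B}"
      using N unfolding mat_set_pow_def by blast
    then consider p s where "N = mat2 p 0 0 s" "\<bar>p\<bar> \<le> m ^ n" "\<bar>s\<bar> \<le> m ^ n"
      | q r where "N = mat2 0 q r 0" "\<bar>q * r\<bar> \<le> (m ^ n)\<^sup>2"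
      using foldr_diagonal_antidiagonal[OF m(1,2) bc, of Ms] unfolding A B by blast
    then show ?thesis
    proof cases
      case 1
      then show ?thesis by (simp add: real_spectral_radius_diagonal)
    next
      case 2
      then show ?thesis
        using m0 by (simp add: real_spectral_radius_antidiagonal real_le_lsqrt)
    qed
  qed
  \<comment> \<open>The maximum m is the radius of A or of B; that matrix is the one attaining the
    supremum.\<close>
  obtain M where M: "M \<in> {A, B}" "real_spectral_radius M = m"
    by (cases "real_spectral_radius A \<le> real_spectral_radius B") (auto simp: m_def max_def)
  have "M \<in> carrier_mat 2 2"
    using M(1) by (auto simp: A B)
  from generalized_spectral_radius_attained[OF _ M(1) this] show ?thesis
    using bound m0 M(2) by (simp add: m_def)
qed

end
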